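(* Consider the system for the unknowns $u_1,u_2,U,v_1,v_2,V,w_1,w_2,W$, in terms of the independent variables $x_1,x_2,X,y_1,y_2,Y,z_1,z_2,Z$, consisting of the matrix equation $$M_{12}(u_1,u_2,U)M_{13}(v_1,v_2,V)M_{23}(w_1,w_2,W)=M_{23}(z_1,z_2,Z)M_{13}(y_1,y_2,Y)M_{12}(x_1,x_2,X)$$ together with $U-u_1u_2=X-x_1x_2$. Put $$\Delta=y_1y_2z_1(x_1y_2+z_2)X-(x_1y_2z_1+z_1z_2-Z)XY+x_2[y_1z_2+x_1(y_1y_2-Y)]Z.$$ Then this system has a unique solution, namely the map $T:(x_1,x_2,X,y_1,y_2,Y,z_1,z_2,Z)\mapsto(u_1,u_2,U,v_1,v_2,V,w_1,w_2,W)$ given by $$u_1=\frac{x_1(y_1y_2-Y)+y_1z_2}{z_1z_2-Z},\quad u_2=\frac{(x_1x_2-X)(y_2z_1X+x_2Z)(z_1z_2-Z)}{\Delta},\quad U=\frac{(x_1x_2-X)(z_1z_2-Z)XY}{\Delta},$$ $$v_1=\frac{x_1z_1(y_1y_2-Y)+y_1Z}{(x_1x_2-X)(z_1z_2-Z)},\quad v_2=x_2z_2+y_2X,\quad V=\frac{\Delta}{(x_1x_2-X)(z_1z_2-Z)},$$ $$w_1=\frac{[x_2y_1Z+z_1(y_1y_2-Y)X](z_1z_2-Z)}{\Delta},\quad w_2=x_1y_2+z_2,\quad W=\frac{(x_1x_2-X)(z_1z_2-Z)YZ}{\Delta}.$$ Moreover, $T$ is a nine-dimensional noninvolutive tetrahedron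 map.
   Context: For scalars, $M(x_1,x_2,X)=\begin{pmatrix} X & x_1\\ x_2 & 1\end{pmatrix}$. For a $2\times2$ matrix $M=\begin{pmatrix}A&B\\C&D\end{pmatrix}$ one sets $$M_{12}=\begin{pmatrix} A&B&0\\ C&D&0\\ 0&0&1\end{pmatrix},\quad M_{13}=\begin{pmatrix} A&0&B\\ 0&1&0\\ C&0&D\end{pmatrix},\quad M_{23}=\begin{pmatrix} 1&0&0\\ 0&A&B\\ 0&C&D\end{pmatrix}.$$ All maps are rational maps, and identities between them (and solvability of the system) are understood generically, i.e. in the field of rational functions over $\mathbb C$ in the independent variables. Tetrahedron map: a (rational) map $T:\mathcal X^3\to\mathcal X^3$ is a tetrahedron map if $$T^{123}\circ T^{145}\circ T^{246}\circ T^{356}=T^{356}\circ T^{246}\circ T^{145}\circ T^{123}$$ on $\mathcal X^6$, where $T^{ijk}$ acts as $T$ on the $i$-th, $j$-th, $k$-th factors (in this order) of $\mathcal X^6$ and as the identity on the other factors. Here $\mathcal X=\mathbb C^3$, the three factors having coordinates $(x_1,x_2,X)$, $(y_1,y_2,Y)$, $(z_1,z_2,Z)$, and the image having coordinates $(u_1,u_2,U)$, $(v_1,v_2,V)$, $(w_1,w_2,W)$. Noninvolutive means $T\circ T\neq\mathrm{id}$. *)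

theory Defs
  imports
    Complex_Main
    "HOL-Library.Poly_Mapping"
    "HOL-Library.Product_Lexorder"
    "HOL-Computational_Algebra.Fraction_Field"
    "HOL-Analysis.Cartesian_Space"
begin

section \<open>Rational functions over the complex numbers\<close>

text \<open>
  Polynomials over the complex numbers in independent variables indexed by \<open>'n\<close> (finitely
  supported maps from exponent vectors to coefficients) and their field of fractions. The linear
  order on \<open>'n\<close> is only needed for the library's proof that the polynomial ring is an integral
  domain; for a product index type it comes from \<open>Product_Lexorder\<close>.
\<close>

type_synonym 'n mpoly = "('n \<Rightarrow>\<^sub>0 nat) \<Rightarrow>\<^sub>0 complex"
type_synonym 'n ratfun = "'n mpoly fract"

definition rat_const :: "complex \<Rightarrow> 'n::linorder ratfun" where
  "rat_const c = Fraction_Field.Fract (Poly_Mapping.single 0 c) 1"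

definition rat_var :: "'n::linorder \<Rightarrow> 'n ratfun" where
  "rat_var i = Fraction_Field.Fract (Poly_Mapping.single (Poly_Mapping.single i 1) 1) 1"

definition mpoly_eval ::
    "('n::{finite,linorder} \<Rightarrow> 'k::linorder ratfun) \<Rightarrow> 'n mpoly \<Rightarrow> 'k ratfun" where
  "mpoly_eval p a =
     (\<Sum>m\<in>Poly_Mapping.keys a. rat_const (Poly_Mapping.lookup a m) *
        (\<Prod>i\<in>UNIV. p i ^ Poly_Mapping.lookup m i))"

text \<open>
  The value of a rational function at a point: defined iff some representation as a fraction has
  a denominator that does not vanish there. It does not depend on the representation.
\<close>

definition rat_eval ::
    "('n::{finite,linorder} \<Rightarrow> 'k::linorder ratfun) \<Rightarrow> 'n ratfun \<rightharpoonup> 'k ratfun" where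
  "rat_eval p r =
     (if \<exists>a b. r = Fraction_Field.Fract a b \<and> mpoly_eval p b \<noteq> 0
      then Some (THE s. \<exists>a b. r = Fraction_Field.Fract a b \<and> mpoly_eval p b \<noteq> 0 \<and>
                              s = mpoly_eval p a / mpoly_eval p b)
      else None)"

section \<open>Rational maps\<close>

text \<open>
  A rational map from the affine space with coordinates indexed by \<open>'m\<close> to the one with
  coordinates indexed by \<open>'n\<close>. The identity map (the generic point) is \<open>rat_var\<close>.
\<close>

type_synonym ('m, 'n) ratmap = "'n \<Rightarrow> 'm ratfun"

text \<open>
  A rational map acts partially on points whose coordinates are rational functions, that is, on
  rational maps: \<open>ratmap_app f g\<close> is the composition of \<open>f\<close> after \<open>g\<close>, if it exists.
\<close>

definition ratmap_app ::
    "('m::{finite,linorder}, 'n) ratmap \<Rightarrow> ('k::linorder, 'm) ratmap \<rightharpoonup> ('k, 'n) ratmap" where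
  "ratmap_app f p =
     (if \<forall>i. rat_eval p (f i) \<noteq> None then Some (\<lambda>i. the (rat_eval p (f i))) else None)"

section \<open>Tetrahedron maps\<close>

text \<open>
  With $\mathcal X=\mathbb C^3$, the coordinates of $\mathcal X^n$ are indexed by pairs
  (factor, coordinate), here of type \<open>3 \<times> 3\<close> for $\mathcal X^3$ and \<open>6 \<times> 3\<close> for
  $\mathcal X^6$. In the numeral types \<open>3\<close> and \<open>6\<close> the last index \<open>3\<close> resp. \<open>6\<close> is the element
  \<open>0\<close>, so \<open>1, 2, 3 :: 3\<close> and \<open>1, \<dots>, 6 :: 6\<close> are pairwise distinct and exhaust the types.
\<close>

definition point3 :: "'a \<times> 'a \<times> 'a \<Rightarrow> 'a \<times> 'a \<times> 'a \<Rightarrow> 'a \<times> 'a \<times> 'a \<Rightarrow> 3 \<times> 3 \<Rightarrow> 'a" where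
  "point3 p q r = (\<lambda>(f, c).
     (case (if f = 1 then p else if f = 2 then q else r) of
        (s, t, S) \<Rightarrow> if c = 1 then s else if c = 2 then t else S))"

text \<open>\<open>factor_act T i j k\<close> is the map $T^{ijk}$.\<close>

definition factor_act ::
    "(3 \<times> 3, 3 \<times> 3) ratmap \<Rightarrow> 6 \<Rightarrow> 6 \<Rightarrow> 6 \<Rightarrow> ('k::linorder, 6 \<times> 3) ratmap \<rightharpoonup> ('k, 6 \<times> 3) ratmap" where
  "factor_act T i j k p =
     map_option
       (\<lambda>q (l, c). if l = i then q (1, c) else if l = j then q (2, c)
                    else if l = k then q (3, c) else p (l, c))
       (ratmap_app T (\<lambda>(f, c). p (if f = 1 then i else if f = 2 then j else k, c)))"

text \<open>
  Equality of rational maps is equality at the generic point; both composites have to exist.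
\<close>

definition tetrahedron_map :: "(3 \<times> 3, 3 \<times> 3) ratmap \<Rightarrow> bool" where
  "tetrahedron_map T \<longleftrightarrow>
     (\<exists>R :: (6 \<times> 3, 6 \<times> 3) ratmap.
        (factor_act T 1 2 3 \<circ>\<^sub>m factor_act T 1 4 5 \<circ>\<^sub>m factor_act T 2 4 6 \<circ>\<^sub>m factor_act T 3 5 6)
          rat_var = Some R \<and>
        (factor_act T 3 5 6 \<circ>\<^sub>m factor_act T 2 4 6 \<circ>\<^sub>m factor_act T 1 4 5 \<circ>\<^sub>m factor_act T 1 2 3)
          rat_var = Some R)"

definition noninvolutive :: "('n::{finite,linorder}, 'n) ratmap \<Rightarrow> bool" where
  "noninvolutive T \<longleftrightarrow> (\<exists>S. ratmap_app T T = Some S \<and> S \<noteq> rat_var)"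

section \<open>The matrices\<close>

definition M :: "'a::field \<Rightarrow> 'a \<Rightarrow> 'a \<Rightarrow> 'a^2^2" where
  "M x1 x2 X = vector [vector [X, x1], vector [x2, 1]]"

definition ext12 :: "'a::field^2^2 \<Rightarrow> 'a^3^3" where
  "ext12 A = vector [vector [A$1$1, A$1$2, 0],
                     vector [A$2$1, A$2$2, 0],
                     vector [0, 0, 1]]"

definition ext13 :: "'a::field^2^2 \<Rightarrow> 'a^3^3" where
  "ext13 A = vector [vector [A$1$1, 0, A$1$2],
                     vector [0, 1, 0],
                     vector [A$2$1, 0, A$2$2]]"

definition ext23 :: "'a::field^2^2 \<Rightarrow> 'a^3^3" where
  "ext23 A = vector [vector [1, 0, 0],
                     vector [0, A$1$1, A$1$2],
                     vector [0, A$2$1, A$2$2]]"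

end

theory Submission
  imports Defs
begin

text \<open>
  The matrix equation consists of eight scalar equations which, together with the preserved
  determinant, can be solved one unknown after another. The solution also preserves the
  determinants of the second and the third factor.

  For the tetrahedron equation, let the six factors act on a four-dimensional space through the
  planes $12, 13, 23, 14, 24, 34$. Each of the four maps on either side reorders three consecutive
  matrices, so both sides turn $M_{34}M_{24}M_{23}M_{14}M_{13}M_{12}$ into
  $M_{12}M_{13}M_{23}M_{14}M_{24}M_{34}$. Such a factorization with prescribed determinants is
  unique as long as the determinants and the diagonal entries do not vanish.

  All genericity conditions follow by specialization to the point where every factor is the
  identity matrix: it is fixed by the map, and no denominator vanishes there.
\<close>

section \<open>The matrix equation\<close>

lemma distinct_6: "distinct [1, 2, 3, 4, 5, 6 :: 6]"
  by simp

lemma distinct_3: "distinct [1, 2, 3 :: 3]"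
  by simp

lemma exhaust_6: "(l :: 6) = 1 \<or> l = 2 \<or> l = 3 \<or> l = 4 \<or> l = 5 \<or> l = 6"
proof (induct l)
  case (of_int z)
  then have "z = 0 \<or> z = 1 \<or> z = 2 \<or> z = 3 \<or> z = 4 \<or> z = 5" by auto
  then show ?case by auto
qed

text \<open>The triple follows the argument order of \<open>M\<close>: upper right entry, lower left
  entry, upper left entry. The index type stays free so that three and six factors are treated
  alike.\<close>

definition fac :: "('n \<times> 3 \<Rightarrow> 'a) \<Rightarrow> 'n \<Rightarrow> 'a \<times> 'a \<times> 'a" where
  "fac p l = (p (l, 1), p (l, 2), p (l, 3))"

lemma fac_point3 [simp]:
  "fac (point3 a b c) 1 = a" "fac (point3 a b c) 2 = b" "fac (point3 a b c) 3 = c"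
  by (auto simp: fac_def point3_def split: prod.split)

lemma ext_fac: "p = q" if "\<And>l. fac p l = fac q l" for p q :: "'n \<times> 3 \<Rightarrow> 'a"
proof (rule ext, clarify)
  fix l :: 'n and c :: 3
  show "p (l, c) = q (l, c)"
    using that[of l] exhaust_3[of c] by (auto simp: fac_def)
qed

text \<open>The determinant of \<open>M b c A\<close>. The scalar equation of the system says that
  it agrees for the first factors.\<close>

definition qdet :: "'a::field \<times> 'a \<times> 'a \<Rightarrow> 'a" where
  "qdet = (\<lambda>(b, c, A). A - b * c)"

definition tet_denom ::
    "'a::field \<times> 'a \<times> 'a \<Rightarrow> 'a \<times> 'a \<times> 'a \<Rightarrow> 'a \<times> 'a \<times> 'a \<Rightarrow> 'a" where
  "tet_denom = (\<lambda>(x1, x2, X) (y1, y2, Y) (z1, z2, Z).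
     y1 * y2 * z1 * (x1 * y2 + z2) * X - (x1 * y2 * z1 + z1 * z2 - Z) * X * Y
       + x2 * (y1 * z2 + x1 * (y1 * y2 - Y)) * Z)"

text \<open>The map of the theorem over an arbitrary field, so that the same formulas apply to the
  generic point and to its specializations.\<close>

definition tet ::
    "'a::field \<times> 'a \<times> 'a \<Rightarrow> 'a \<times> 'a \<times> 'a \<Rightarrow> 'a \<times> 'a \<times> 'a \<Rightarrow> 3 \<times> 3 \<Rightarrow> 'a" where
  "tet = (\<lambda>(x1, x2, X) (y1, y2, Y) (z1, z2, Z).
     let \<Delta> = tet_denom (x1, x2, X) (y1, y2, Y) (z1, z2, Z) in
     point3
      ((x1 * (y1 * y2 - Y) + y1 * z2) / (z1 * z2 - Z),
       ((x1 * x2 - X) * (y2 * z1 * X + x2 * Z) * (z1 * z2 - Z)) / \<Delta>,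
       ((x1 * x2 - X) * (z1 * z2 - Z) * X * Y) / \<Delta>)
      ((x1 * z1 * (y1 * y2 - Y) + y1 * Z) / ((x1 * x2 - X) * (z1 * z2 - Z)),
       x2 * z2 + y2 * X,
       \<Delta> / ((x1 * x2 - X) * (z1 * z2 - Z)))
      (((x2 * y1 * Z + z1 * (y1 * y2 - Y) * X) * (z1 * z2 - Z)) / \<Delta>,
       x1 * y2 + z2,
       ((x1 * x2 - X) * (z1 * z2 - Z) * Y * Z) / \<Delta>))"

text \<open>The entries of the matrix equation; the name refers to the local Yang--Baxter equation.\<close>

definition lyb ::
    "'a::field \<times> 'a \<times> 'a \<Rightarrow> 'a \<times> 'a \<times> 'a \<Rightarrow> 'a \<times> 'a \<times> 'a \<Rightarrow>
     'a \<times> 'a \<times> 'a \<Rightarrow> 'a \<times> 'a \<times> 'a \<Rightarrow> 'a \<times> 'a \<times> 'a \<Rightarrow> bool" where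
  "lyb = (\<lambda>(u1, u2, U) (v1, v2, V) (w1, w2, W) (x1, x2, X) (y1, y2, Y) (z1, z2, Z).
     U * V = X * Y \<and> u1 * W + U * v1 * w2 = x1 * Y \<and> u1 * w1 + U * v1 = y1 \<and>
     u2 * V = x2 * Z + z1 * y2 * X \<and> W + u2 * v1 * w2 = Z + z1 * y2 * x1 \<and> w1 + u2 * v1 = z1 \<and>
     v2 = x2 * z2 + y2 * X \<and> w2 = x1 * y2 + z2)"

text \<open>The lower right entry reads 1 = 1, which leaves eight equations.\<close>

lemma matrix_equation_iff_lyb:
  "ext12 (M u1 u2 U) ** ext13 (M v1 v2 V) ** ext23 (M w1 w2 W) =
     ext23 (M z1 z2 Z) ** ext13 (M y1 y2 Y) ** ext12 (M x1 x2 X) \<longleftrightarrow>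
   lyb (u1, u2, U) (v1, v2, V) (w1, w2, W) (x1, x2, X) (y1, y2, Y) (z1, z2, Z)"
  by (simp add: ext12_def ext13_def ext23_def M_def lyb_def matrix_matrix_mult_def vec_eq_iff
      forall_3 sum_3 algebra_simps)

text \<open>\<open>v2\<close> and \<open>w2\<close> can be read off and yield the determinant of
  \<open>w\<close>. After that, \<open>u1\<close>, \<open>v1\<close>, \<open>V\<close>,
  \<open>U\<close>, \<open>u2\<close>, \<open>w1\<close> and \<open>W\<close> are obtained in this
  order, each from a linear equation.\<close>

lemma lyb_unique:
  assumes "qdet x \<noteq> 0" "qdet z \<noteq> 0" "tet_denom x y z \<noteq> 0"
    and "lyb u v w x y z" "qdet u = qdet x"
  shows "point3 u v w = tet x y z"
proof -
  obtain x1 x2 X where x: "x = (x1, x2, X)" by (cases x)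
  obtain y1 y2 Y where y: "y = (y1, y2, Y)" by (cases y)
  obtain z1 z2 Z where z: "z = (z1, z2, Z)" by (cases z)
  obtain u1 u2 U where u: "u = (u1, u2, U)" by (cases u)
  obtain v1 v2 V where v: "v = (v1, v2, V)" by (cases v)
  obtain w1 w2 W where w: "w = (w1, w2, W)" by (cases w)
  \<comment> \<open>As in the formulas of the theorem, \<open>a\<close> and \<open>b\<close> are the
    negatives of the determinants of \<open>x\<close> and \<open>z\<close>.\<close>
  define a where "a = x1 * x2 - X"
  define b where "b = z1 * z2 - Z"
  define D where "D = tet_denom x y z"
  have nz: "a \<noteq> 0" "b \<noteq> 0" "D \<noteq> 0"
    using assms by (auto simp: a_def b_def D_def x y z qdet_def)
  have D: "D = y1 * y2 * z1 * (x1 * y2 + z2) * X - (x1 * y2 * z1 + z1 * z2 - Z) * X * Y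
       + x2 * (y1 * z2 + x1 * (y1 * y2 - Y)) * Z"
    by (simp add: D_def tet_denom_def x y z)
  have e: "U * V = X * Y" "u1 * W + U * v1 * w2 = x1 * Y" "u1 * w1 + U * v1 = y1"
     "u2 * V = x2 * Z + z1 * y2 * X" "W + u2 * v1 * w2 = Z + z1 * y2 * x1" "w1 + u2 * v1 = z1"
     and v2: "v2 = x2 * z2 + y2 * X" and w2: "w2 = x1 * y2 + z2"
     and d: "u1 * u2 - U = a"
    using assms(4,5) by (auto simp: lyb_def x y z u v w a_def qdet_def algebra_simps)
  \<comment> \<open>Subtracting \<open>w2\<close> times the sixth equation from the fifth cancels
    the terms with \<open>u2 * v1\<close>.\<close>
  have dw: "w1 * w2 - W = b"
    using e(5,6) unfolding w2 b_def by algebra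
  \<comment> \<open>Likewise, \<open>w2\<close> times the third equation minus the second cancels
    the terms with \<open>U * v1\<close>.\<close>
  have "u1 * b = x1 * (y1 * y2 - Y) + y1 * z2"
    using e(2,3) w2 unfolding dw[symmetric] by algebra
  then have u1: "u1 = (x1 * (y1 * y2 - Y) + y1 * z2) / b"
    using nz by (simp add: field_simps)
  \<comment> \<open>\<open>u1\<close> times the sixth equation minus the third leaves
    \<open>v1\<close> times \<open>u1 * u2 - U\<close>, which is prescribed. The first and fourth
    equations give \<open>V\<close> in the same way.\<close>
  have "v1 * a = u1 * z1 - y1" unfolding e(3,6)[symmetric] d[symmetric] by algebra
  then have "v1 * (a * b) = x1 * z1 * (y1 * y2 - Y) + y1 * Z"
    using \<open>u1 * b = _\<close> b_def by algebra
  then have v1: "v1 = (x1 * z1 * (y1 * y2 - Y) + y1 * Z) / (a * b)"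
    using nz by (simp add: field_simps)
  have "V * a = u1 * (x2 * Z + z1 * y2 * X) - X * Y"
    unfolding e(1,4)[symmetric] d[symmetric] using e(4) by algebra
  \<comment> \<open>So \<Delta> is \<open>V\<close> times the product of the determinants of
    \<open>x\<close> and \<open>z\<close>.\<close>
  then have VD: "V * (a * b) = D"
    using \<open>u1 * b = _\<close> b_def D by algebra
  then have V: "V = D / (a * b)" using nz by (simp add: field_simps)
  have "V \<noteq> 0" using VD nz by auto
  have "U * D = a * b * X * Y" using e(1) VD by algebra
  then have U: "U = a * b * X * Y / D" using nz by (simp add: field_simps)
  have "u2 * D = a * (y2 * z1 * X + x2 * Z) * b" using e(4) VD by algebra
  then have u2: "u2 = a * (y2 * z1 * X + x2 * Z) * b / D" using nz by (simp add: field_simps)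
  have "w1 * D = z1 * D - (u2 * D) * v1" unfolding e(6)[symmetric] by algebra
  also have "\<dots> = z1 * D - (y2 * z1 * X + x2 * Z) * (v1 * (a * b))"
    using \<open>u2 * D = _\<close> by algebra
  also have "\<dots> = (x2 * y1 * Z + z1 * (y1 * y2 - Y) * X) * b"
    unfolding \<open>v1 * (a * b) = _\<close> unfolding D b_def by algebra
  finally have wD: "w1 * D = (x2 * y1 * Z + z1 * (y1 * y2 - Y) * X) * b" .
  then have w1: "w1 = (x2 * y1 * Z + z1 * (y1 * y2 - Y) * X) * b / D"
    using nz by (simp add: field_simps)
  have "W * D = w2 * (w1 * D) - b * D" unfolding dw[symmetric] by algebra
  also have "\<dots> = a * b * Y * Z"
    unfolding wD unfolding w2 D b_def a_def by algebra
  finally have W: "W = a * b * Y * Z / D" using nz by (simp add: field_simps)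
  show ?thesis
    unfolding tet_def Let_def D_def[symmetric] x y z u v w prod.case
    unfolding a_def[symmetric] b_def[symmetric] x[symmetric] y[symmetric] z[symmetric] D_def[symmetric]
    by (simp only: u1[symmetric] u2[symmetric] U[symmetric] v1[symmetric] v2[symmetric] V[symmetric]
        w1[symmetric] w2[symmetric] W[symmetric])
qed

text \<open>Once the nonzero denominators \<open>a\<close>, \<open>b\<close> and \<open>D\<close>
  are cleared, every claim is a polynomial identity modulo their definitions. They stay symbols
  until then to keep the fractions small.\<close>

lemma tet_solves:
  fixes x y z :: "'a::field \<times> 'a \<times> 'a"
  assumes "qdet x \<noteq> 0" "qdet z \<noteq> 0" "tet_denom x y z \<noteq> 0"
  defines "q \<equiv> tet x y z"
  shows tet_lyb: "lyb (fac q 1) (fac q 2) (fac q 3) x y z"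
    and qdet_tet: "qdet (fac q 1) = qdet x" "qdet (fac q 2) = qdet y" "qdet (fac q 3) = qdet z"
proof -
  obtain x1 x2 X where x: "x = (x1, x2, X)" by (cases x)
  obtain y1 y2 Y where y: "y = (y1, y2, Y)" by (cases y)
  obtain z1 z2 Z where z: "z = (z1, z2, Z)" by (cases z)
  define a where "a = x1 * x2 - X"
  define b where "b = z1 * z2 - Z"
  define D where "D = tet_denom x y z"
  have nz: "a \<noteq> 0" "b \<noteq> 0" "D \<noteq> 0"
    using assms by (auto simp: a_def b_def D_def x y z qdet_def)
  have D: "D = y1 * y2 * z1 * (x1 * y2 + z2) * X - (x1 * y2 * z1 + z1 * z2 - Z) * X * Y
       + x2 * (y1 * z2 + x1 * (y1 * y2 - Y)) * Z"
    by (simp add: D_def tet_denom_def x y z)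
  have q: "q = point3
      ((x1 * (y1 * y2 - Y) + y1 * z2) / b, (a * (y2 * z1 * X + x2 * Z) * b) / D, (a * b * X * Y) / D)
      ((x1 * z1 * (y1 * y2 - Y) + y1 * Z) / (a * b), x2 * z2 + y2 * X, D / (a * b))
      (((x2 * y1 * Z + z1 * (y1 * y2 - Y) * X) * b) / D, x1 * y2 + z2, (a * b * Y * Z) / D)"
    unfolding q_def tet_def Let_def x y z prod.case a_def b_def D_def by (rule refl)
  show "lyb (fac q 1) (fac q 2) (fac q 3) x y z"
    unfolding q fac_point3 lyb_def x y z prod.case using nz
    apply (intro conjI)
    apply (simp_all add: divide_simps del: mult_eq_0_iff)
    apply (use D a_def b_def in algebra)+
    done
  show "qdet (fac q 1) = qdet x" "qdet (fac q 2) = qdet y" "qdet (fac q 3) = qdet z"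
    unfolding q fac_point3 qdet_def x y z prod.case using nz
    by (simp_all add: divide_simps) (use D a_def b_def in algebra)+
qed

lemma tet_iff:
  assumes "qdet x \<noteq> 0" "qdet z \<noteq> 0" "tet_denom x y z \<noteq> 0"
  shows "lyb u v w x y z \<and> qdet u = qdet x \<longleftrightarrow> point3 u v w = tet x y z"
  using assms lyb_unique tet_solves by (metis fac_point3)

section \<open>Unique factorization of four by four matrices\<close>

text \<open>
  \<open>emb i j t\<close> is the matrix \<open>M\<close> with parameters \<open>t\<close> acting on the coordinate plane of \<open>i\<close>
  and \<open>j\<close>, for an arbitrary index type, so that one lemma covers all four coordinate
  three-spaces of the four-dimensional space.
\<close>

definition emb :: "'n \<Rightarrow> 'n \<Rightarrow> 'a::field \<times> 'a \<times> 'a \<Rightarrow> ('n \<Rightarrow> 'a) \<Rightarrow> 'n \<Rightarrow> 'a" where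
  "emb i j t v = (case t of (b, c, A) \<Rightarrow> v(i := A * v i + b * v j, j := c * v i + v j))"

text \<open>The two maps read and change disjoint pairs of coordinates. In dimension four this
  concerns the pairs of planes 12 and 34, 13 and 24, 14 and 23.\<close>

lemma emb_commute:
  assumes "distinct [i, j, k, l]"
  shows "emb i j s (emb k l t v) = emb k l t (emb i j s v)"
  using assms by (auto simp: emb_def fun_eq_iff split: prod.split)

text \<open>Both sides are the two matrix products applied to the coordinates \<open>i\<close>,
  \<open>j\<close>, \<open>k\<close> of \<open>f\<close>. Each of the three rows is a linear
  combination of the entry equations for that row.\<close>

lemma lyb_emb:
  assumes "lyb u v w x y z" "distinct [i, j, k]"
  shows "emb i j u (emb i k v (emb j k w f)) = emb j k z (emb i k y (emb i j x f))"
proof -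
  obtain x1 x2 X where x: "x = (x1, x2, X)" by (cases x)
  obtain y1 y2 Y where y: "y = (y1, y2, Y)" by (cases y)
  obtain z1 z2 Z where z: "z = (z1, z2, Z)" by (cases z)
  obtain u1 u2 U where u: "u = (u1, u2, U)" by (cases u)
  obtain v1 v2 V where v: "v = (v1, v2, V)" by (cases v)
  obtain w1 w2 W where w: "w = (w1, w2, W)" by (cases w)
  have e: "U * V = X * Y" "u1 * W + U * v1 * w2 = x1 * Y" "u1 * w1 + U * v1 = y1"
     "u2 * V = x2 * Z + z1 * y2 * X" "W + u2 * v1 * w2 = Z + z1 * y2 * x1" "w1 + u2 * v1 = z1"
     "v2 = x2 * z2 + y2 * X" "w2 = x1 * y2 + z2"
    using assms by (auto simp: lyb_def x y z u v w)
  have i: "U * (V * f i + v1 * (w2 * f j + f k)) + u1 * (W * f j + w1 * f k)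
      = Y * (X * f i + x1 * f j) + y1 * f k"
    using e(1-3) by algebra
  have j: "u2 * (V * f i + v1 * (w2 * f j + f k)) + (W * f j + w1 * f k) =
      Z * (x2 * f i + f j) + z1 * (y2 * (X * f i + x1 * f j) + f k)"
    using e(4-6) by algebra
  have k: "v2 * f i + (w2 * f j + f k) = z2 * (x2 * f i + f j) + (y2 * (X * f i + x1 * f j) + f k)"
    using e(7,8) by algebra
  have neq: "i \<noteq> j" "j \<noteq> i" "i \<noteq> k" "k \<noteq> i" "j \<noteq> k" "k \<noteq> j"
    using assms(2) by auto
  show ?thesis
  proof
    fix m
    consider "m = i" | "m = j" | "m = k" | "m \<noteq> i \<and> m \<noteq> j \<and> m \<noteq> k" by blast
    then show "emb i j u (emb i k v (emb j k w f)) m = emb j k z (emb i k y (emb i j x f)) m"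
      by cases (simp_all add: emb_def x y z u v w i j k neq)
  qed
qed

lemma qdet_emb_inverse:
  assumes "qdet t \<noteq> 0" "i \<noteq> j"
  obtains g where "\<And>v. emb i j t (g v) = v" "\<And>v. g (emb i j t v) = v"
proof -
  obtain b c A where t: "t = (b, c, A)" by (cases t)
  define d where "d = A - b * c"
  then have d: "d \<noteq> 0" and A: "A = d + b * c" using assms by (simp_all add: t qdet_def)
  \<comment> \<open>Cramer's rule in the plane of \<open>i\<close> and \<open>j\<close>.\<close>
  define g where "g v = v(i := (v i - b * v j) / d, j := (A * v j - c * v i) / d)" for v
  have "emb i j t (g v) m = v m" "g (emb i j t v) m = v m" for v m
  proof -
    have "A * ((v i - b * v j) / d) + b * ((A * v j - c * v i) / d) = v i"
      "c * ((v i - b * v j) / d) + (A * v j - c * v i) / d = v j"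
      using d by (simp_all add: A field_simps)
    then show "emb i j t (g v) m = v m"
      using assms(2) by (simp add: emb_def t g_def)
    have "(A * v i + b * v j - b * (c * v i + v j)) / d = v i"
      "(A * (c * v i + v j) - c * (A * v i + b * v j)) / d = v j"
      using d by (simp_all add: A field_simps)
    then show "g (emb i j t v) m = v m"
      using assms(2) by (simp add: emb_def t g_def)
  qed
  then have "emb i j t (g v) = v" "g (emb i j t v) = v" for v by (simp_all add: fun_eq_iff)
  then show thesis by (rule that)
qed

lemma bij_emb:
  assumes "qdet t \<noteq> 0" "i \<noteq> j"
  shows "bij (emb i j t)"
proof -
  obtain g where "\<And>v. emb i j t (g v) = v" "\<And>v. g (emb i j t v) = v"
    using qdet_emb_inverse[OF assms] by blast
  then show ?thesis by (intro bij_betw_byWitness[of UNIV g]) simp_all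
qed

text \<open>The images of the three basis vectors are compared. The third determinant isolates the
  upper right entry of the first factor, and the first determinant then isolates that of the second.
  The second determinant fixes the diagonal entry of the second factor, and division by it gives the
  rest.\<close>

lemma factorization3_unique:
  fixes i j k :: 'n
  assumes ijk: "distinct [i, j, k]"
    and eq: "\<And>f. emb i j a1 (emb i k a2 (emb j k a3 f)) = emb i j b1 (emb i k b2 (emb j k b3 f))"
    and det: "qdet a1 = qdet b1" "qdet a2 = qdet b2" "qdet a3 = qdet b3"
    and nz: "qdet a1 \<noteq> 0" "qdet a3 \<noteq> 0" "snd (snd a2) \<noteq> 0"
  shows "a1 = b1" "a2 = b2" "a3 = b3"
proof -
  obtain b1a c1 A1 where a1: "a1 = (b1a, c1, A1)" by (cases a1)
  obtain b2a c2 A2 where a2: "a2 = (b2a, c2, A2)" by (cases a2)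
  obtain b3a c3 A3 where a3: "a3 = (b3a, c3, A3)" by (cases a3)
  obtain e1 f1 B1 where b1: "b1 = (e1, f1, B1)" by (cases b1)
  obtain e2 f2 B2 where b2: "b2 = (e2, f2, B2)" by (cases b2)
  obtain e3 f3 B3 where b3: "b3 = (e3, f3, B3)" by (cases b3)
  note defs = emb_def a1 a2 a3 b1 b2 b3 fun_eq_iff
  have d: "A1 - b1a * c1 = B1 - e1 * f1" "A2 - b2a * c2 = B2 - e2 * f2" "A3 - b3a * c3 = B3 - e3 * f3"
    using det by (simp_all add: qdet_def a1 a2 a3 b1 b2 b3)
  have nz': "A1 - b1a * c1 \<noteq> 0" "A3 - b3a * c3 \<noteq> 0" "A2 \<noteq> 0"
    using nz by (simp_all add: qdet_def a1 a2 a3)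
  have c: "c2 = f2" "A1 * A2 = B1 * B2" "c1 * A2 = f1 * B2"
    using eq[of "(\<lambda>_. 0)(i := 1)"] ijk by (auto simp: defs dest: spec[of _ i] spec[of _ j] spec[of _ k])
  have h: "A1 * b2a + b1a * b3a = B1 * e2 + e1 * e3" "c1 * b2a + b3a = f1 * e2 + e3"
    using eq[of "(\<lambda>_. 0)(k := 1)"] ijk by (auto simp: defs dest: spec[of _ i] spec[of _ j] spec[of _ k])
  have g: "c3 = f3" "A1 * (b2a * c3) + b1a * A3 = B1 * (e2 * f3) + e1 * B3"
    using eq[of "(\<lambda>_. 0)(j := 1)"] ijk by (auto simp: defs dest: spec[of _ i] spec[of _ j] spec[of _ k])
  have "b1a * (A3 - b3a * c3) = e1 * (A3 - b3a * c3)"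
    using d(3) g h by algebra
  then have 1: "b1a = e1" using nz' by simp
  have "b2a * (A1 - b1a * c1) = e2 * (A1 - b1a * c1)"
    using d(1) 1 h by algebra
  then have 2: "b2a = e2" using nz' by simp
  have 3: "A2 = B2" using d(2) 2 c by simp
  have 4: "A1 = B1" "c1 = f1" using 3 c nz' by auto
  have 5: "b3a = e3" using h 4 2 by simp
  have 6: "A3 = B3" using d(3) 5 g by simp
  show "a1 = b1" "a2 = b2" "a3 = b3"
    using 1 2 3 4 5 6 c g by (simp_all add: a1 a2 a3 b1 b2 b3)
qed

text \<open>The first three maps preserve coordinate \<open>l\<close> and fix the basis vector of
  \<open>l\<close>. Hence the last row of the product gives the lower left entries of the last three
  factors, and that basis vector gives access to their upper right entries. What remains is a
  factorization in dimension three.\<close>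

lemma factorization4_last_unique:
  fixes i j k l :: 'n
  assumes ijkl: "distinct [i, j, k, l]"
    and eq: "\<And>f. emb i j a1 (emb i k a2 (emb j k a3 (emb i l a4 (emb j l a5 (emb k l a6 f))))) =
       emb i j b1 (emb i k b2 (emb j k b3 (emb i l b4 (emb j l b5 (emb k l b6 f)))))"
    and det: "qdet a4 = qdet b4" "qdet a5 = qdet b5" "qdet a6 = qdet b6"
    and nz: "\<And>a. a \<in> {b1, b2, b3, a4, a5, a6} \<Longrightarrow> qdet a \<noteq> 0"
      "\<And>a. a \<in> {a4, a5} \<Longrightarrow> snd (snd a) \<noteq> 0"
  shows "a4 = b4" "a5 = b5" "a6 = b6"
proof -
  obtain p4 c4 A4 where a4: "a4 = (p4, c4, A4)" by (cases a4)
  obtain p5 c5 A5 where a5: "a5 = (p5, c5, A5)" by (cases a5)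
  obtain p6 c6 A6 where a6: "a6 = (p6, c6, A6)" by (cases a6)
  obtain q4 f4 B4 where b4: "b4 = (q4, f4, B4)" by (cases b4)
  obtain q5 f5 B5 where b5: "b5 = (q5, f5, B5)" by (cases b5)
  obtain q6 f6 B6 where b6: "b6 = (q6, f6, B6)" by (cases b6)
  \<comment> \<open>Both factorizations send the vector \<open>s\<close> to the image of the last basis vector minus that
    vector itself, so the two versions of \<open>s\<close> agree by injectivity; the entries of \<open>s\<close> determine
    \<open>p4\<close>, \<open>p5\<close> and \<open>p6\<close> successively.\<close>
  define Qa where "Qa f = emb i j a1 (emb i k a2 (emb j k a3 f))" for f
  define Qb where "Qb f = emb i j b1 (emb i k b2 (emb j k b3 f))" for f
  define Ra where "Ra f = emb i l a4 (emb j l a5 (emb k l a6 f))" for f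
  define Rb where "Rb f = emb i l b4 (emb j l b5 (emb k l b6 f))" for f
  have eq: "Qa (Ra f) = Qb (Rb f)" for f
    using eq by (simp add: Qa_def Qb_def Ra_def Rb_def)
  have Ql: "Qa f l = f l" "Qb f l = f l" for f
    using ijkl by (auto simp: Qa_def Qb_def emb_def split: prod.split)
  have Qdiff: "Qa (\<lambda>x. f x - g x) = (\<lambda>x. Qa f x - Qa g x)" "Qb (\<lambda>x. f x - g x) = (\<lambda>x. Qb f x - Qb g x)" for f g
    using ijkl by (auto simp: Qa_def Qb_def emb_def fun_eq_iff algebra_simps split: prod.split)
  have Rl: "Ra f l = c4 * f i + (c5 * f j + (c6 * f k + f l))"
      "Rb f l = f4 * f i + (f5 * f j + (f6 * f k + f l))" for f
    using ijkl by (simp_all add: Ra_def Rb_def emb_def a4 a5 a6 b4 b5 b6)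
  have row: "c4 * f i + (c5 * f j + (c6 * f k + f l)) = f4 * f i + (f5 * f j + (f6 * f k + f l))" for f :: "'n \<Rightarrow> 'a"
    using eq[of f] by (metis Ql Rl)
  have c: "c4 = f4" "c5 = f5" "c6 = f6"
    using row[of "(\<lambda>_. 0)(i := 1)"] row[of "(\<lambda>_. 0)(j := 1)"] row[of "(\<lambda>_. 0)(k := 1)"] ijkl by auto
  have d: "A4 - p4 * c4 = B4 - q4 * f4" "A5 - p5 * c5 = B5 - q5 * f5" "A6 - p6 * c6 = B6 - q6 * f6"
    using det by (simp_all add: qdet_def a4 a5 a6 b4 b5 b6)
  define d4 where "d4 = A4 - p4 * c4"
  define d5 where "d5 = A5 - p5 * c5"
  define d6 where "d6 = A6 - p6 * c6"
  have nz': "d4 \<noteq> 0" "d5 \<noteq> 0" "d6 \<noteq> 0" "A4 \<noteq> 0" "A5 \<noteq> 0"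
    using nz[of a4] nz[of a5] nz(1)[of a6] by (auto simp: qdet_def a4 a5 a6 d4_def d5_def d6_def)
  have A: "A4 = d4 + p4 * c4" "A5 = d5 + p5 * c5" "A6 = d6 + p6 * c6"
     "B4 = d4 + q4 * c4" "B5 = d5 + q5 * c5" "B6 = d6 + q6 * c6"
    using d by (simp_all add: c d4_def d5_def d6_def algebra_simps)
  define s where "s p4 p5 p6 = (let s1 = p4 / d4; s2 = p5 * (1 + c4 * s1) / d5;
      s3 = p6 * (1 + c4 * s1 + c5 * s2) / d6
     in (\<lambda>_. 0)(i := s1, j := s2, k := s3, l := - (c4 * s1 + (c5 * s2 + c6 * s3))))" for p4 p5 p6
  define el :: "'n \<Rightarrow> 'a" where "el = (\<lambda>_. 0)(l := 1)"
  have Ra: "Ra (s p4 p5 p6) = (\<lambda>x. Ra el x - el x)"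
    using ijkl nz'(1-3)
    by (simp add: Ra_def emb_def a4 a5 a6 A el_def s_def Let_def fun_eq_iff) (simp add: field_simps)
  have Rb: "Rb (s q4 q5 q6) = (\<lambda>x. Rb el x - el x)"
    using ijkl nz'(1-3)
    by (simp add: Rb_def emb_def b4 b5 b6 c[symmetric] A el_def s_def Let_def fun_eq_iff) (simp add: field_simps)
  have Qel: "Qa el = el" "Qb el = el"
    using ijkl by (auto simp: Qa_def Qb_def emb_def el_def fun_eq_iff split: prod.split)
  have "Qb (Rb (s p4 p5 p6)) = Qa (\<lambda>x. Ra el x - el x)"
    by (simp only: eq[symmetric] Ra)
  also have "\<dots> = Qb (\<lambda>x. Rb el x - el x)"
    by (simp only: Qdiff Qel eq)
  finally have "Qb (Rb (s p4 p5 p6)) = Qb (Rb (s q4 q5 q6))"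
    by (simp only: Rb)
  moreover have "inj Qb"
  proof -
    have "Qb = emb i j b1 \<circ> (emb i k b2 \<circ> emb j k b3)"
      by (simp add: Qb_def fun_eq_iff)
    then show ?thesis
      using nz(1) ijkl by (simp only:) (intro inj_compose bij_is_inj bij_emb; simp)
  qed
  moreover have "inj Rb"
  proof -
    have "Rb = emb i l b4 \<circ> (emb j l b5 \<circ> emb k l b6)"
      by (simp add: Rb_def fun_eq_iff)
    then show ?thesis
      using nz(1) ijkl
      by (simp only:) (intro inj_compose bij_is_inj bij_emb; simp flip: det)
  qed
  ultimately have s: "s p4 p5 p6 = s q4 q5 q6" by (simp add: inj_eq)
  have s1: "p4 / d4 = q4 / d4"
    using fun_cong[OF s, of i] ijkl by (simp add: s_def Let_def)
  then have 4: "p4 = q4" using nz' by simp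
  \<comment> \<open>The coefficient of \<open>p5\<close> in \<open>s\<close> is nonzero because the
    diagonal entry \<open>A4\<close> is; that of \<open>p6\<close> contains the further factor
    \<open>A5 / d5\<close>.\<close>
  have "1 + c4 * (p4 / d4) = A4 / d4" using nz' by (simp add: A field_simps)
  then have n1: "1 + c4 * (p4 / d4) \<noteq> 0" using nz' by simp
  have "p5 * (1 + c4 * (p4 / d4)) / d5 = q5 * (1 + c4 * (p4 / d4)) / d5"
    using fun_cong[OF s, of j] ijkl by (simp add: s_def Let_def 4)
  then have 5: "p5 = q5" using nz' n1 by simp
  have 6: "p6 = q6" if n2: "1 + c4 * (p4 / d4) + c5 * (p5 * (1 + c4 * (p4 / d4)) / d5) \<noteq> 0"
  proof -
    have "p6 * (1 + c4 * (p4 / d4) + c5 * (p5 * (1 + c4 * (p4 / d4)) / d5)) / d6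
        = q6 * (1 + c4 * (p4 / d4) + c5 * (p5 * (1 + c4 * (p4 / d4)) / d5)) / d6"
      using fun_cong[OF s, of k] ijkl by (simp add: s_def Let_def 4 5)
    then show "p6 = q6" using nz' n2 by simp
  qed
  have "1 + c4 * (p4 / d4) + c5 * (p5 * (1 + c4 * (p4 / d4)) / d5) = (1 + c4 * (p4 / d4)) * (A5 / d5)"
    using nz' by (simp add: A field_simps)
  then have 6: "p6 = q6" using 6 n1 nz' by simp
  show "a4 = b4" "a5 = b5" "a6 = b6"
    by (simp_all add: a4 a5 a6 b4 b5 b6 A c 4 5 6)
qed

section \<open>The tetrahedron equation over a field\<close>

text \<open>This version is total, with division by zero as in any field, so composites are plain
  function values; \<open>regular\<close> records separately that no denominator vanishes.\<close>

definition act :: "'n \<Rightarrow> 'n \<Rightarrow> 'n \<Rightarrow> ('n \<times> 3 \<Rightarrow> 'a::field) \<Rightarrow> 'n \<times> 3 \<Rightarrow> 'a" where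
  "act i j k p = (\<lambda>(l, c).
     let q = tet (fac p i) (fac p j) (fac p k) in
     if l = i then q (1, c) else if l = j then q (2, c) else if l = k then q (3, c) else p (l, c))"

definition regular :: "'a::field \<times> 'a \<times> 'a \<Rightarrow> 'a \<times> 'a \<times> 'a \<Rightarrow> 'a \<times> 'a \<times> 'a \<Rightarrow> bool" where
  "regular x y z \<longleftrightarrow> qdet x \<noteq> 0 \<and> qdet z \<noteq> 0 \<and> tet_denom x y z \<noteq> 0"

lemma fac_act:
  assumes "distinct [i, j, k]"
  shows "fac (act i j k p) i = fac (tet (fac p i) (fac p j) (fac p k)) 1"
    "fac (act i j k p) j = fac (tet (fac p i) (fac p j) (fac p k)) 2"
    "fac (act i j k p) k = fac (tet (fac p i) (fac p j) (fac p k)) 3"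
    "l \<notin> {i, j, k} \<Longrightarrow> fac (act i j k p) l = fac p l"
  using assms by (auto simp: fac_def act_def Let_def)

lemma act_3: "act 1 2 3 p = tet (fac p 1) (fac p 2) (fac p 3)" for p :: "3 \<times> 3 \<Rightarrow> 'a::field"
proof (rule ext_fac)
  fix l :: 3
  show "fac (act 1 2 3 p) l = fac (tet (fac p 1) (fac p 2) (fac p 3)) l"
    using exhaust_3[of l] fac_act(1-3)[OF distinct_3, of p] by metis
qed

lemma qdet_act:
  assumes "distinct [i, j, k]" "regular (fac p i) (fac p j) (fac p k)"
  shows "qdet (fac (act i j k p) l) = qdet (fac p l)"
proof (cases "l \<in> {i, j, k}")
  case True
  then show ?thesis
    using assms(2) fac_act(1-3)[OF assms(1), of p] qdet_tet[of "fac p i" "fac p k" "fac p j"]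
    by (auto simp: regular_def)
qed (simp add: fac_act(4)[OF assms(1)])

text \<open>The factors \<open>i\<close>, \<open>j\<close>, \<open>k\<close> act in the planes
  \<open>a b\<close>, \<open>a c\<close>, \<open>b c\<close>. Factor labels and coordinates are
  independent, so every step on either side of the tetrahedron equation is an instance.\<close>

lemma emb_act:
  assumes "distinct [i, j, k]" "regular (fac p i) (fac p j) (fac p k)" "distinct [a, b, c]"
  shows "emb b c (fac p k) (emb a c (fac p j) (emb a b (fac p i) f)) =
    emb a b (fac (act i j k p) i) (emb a c (fac (act i j k p) j) (emb b c (fac (act i j k p) k) f))"
  using lyb_emb[OF tet_lyb assms(3), of "fac p i" "fac p k" "fac p j" f] assms(2)
  by (simp add: fac_act(1-3)[OF assms(1)] regular_def)

lemma tetrahedron_act: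
  fixes p :: "6 \<times> 3 \<Rightarrow> 'a::field"
  defines "p1 \<equiv> act 3 5 6 p" and "q1 \<equiv> act 1 2 3 p"
  defines "p2 \<equiv> act 2 4 6 p1" and "q2 \<equiv> act 1 4 5 q1"
  defines "p3 \<equiv> act 1 4 5 p2" and "q3 \<equiv> act 2 4 6 q2"
  defines "p4 \<equiv> act 1 2 3 p3" and "q4 \<equiv> act 3 5 6 q3"
  assumes det: "\<And>l. qdet (fac p l) \<noteq> 0"
    and diag: "\<And>l. snd (snd (fac p4 l)) \<noteq> 0"
    and regular: "regular (fac p 3) (fac p 5) (fac p 6)" "regular (fac p1 2) (fac p1 4) (fac p1 6)"
      "regular (fac p2 1) (fac p2 4) (fac p2 5)" "regular (fac p3 1) (fac p3 2) (fac p3 3)"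
      "regular (fac p 1) (fac p 2) (fac p 3)" "regular (fac q1 1) (fac q1 4) (fac q1 5)"
      "regular (fac q2 2) (fac q2 4) (fac q2 6)" "regular (fac q3 3) (fac q3 5) (fac q3 6)"
  shows "p4 = q4"
proof -
  \<comment> \<open>Coordinates are the numbers 1 to 4, and the factors 1 to 6 act in the planes 12,
    13, 23, 14, 24, 34 in this order.\<close>
  define E :: "nat \<Rightarrow> nat \<Rightarrow> 'a \<times> 'a \<times> 'a \<Rightarrow> (nat \<Rightarrow> 'a) \<Rightarrow> nat \<Rightarrow> 'a" where "E = emb"
  have dist: "distinct [3, 5, 6 :: 6]" "distinct [2, 4, 6 :: 6]" "distinct [1, 4, 5 :: 6]"
      "distinct [1, 2, 3 :: 6]"
    using distinct_6 by simp_all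
  \<comment> \<open>Exchanging maps in complementary planes brings the next triple of factors
    together.\<close>
  have comm: "E 3 4 s (E 1 2 t f) = E 1 2 t (E 3 4 s f)"
    "E 2 4 s (E 1 3 t f) = E 1 3 t (E 2 4 s f)"
    "E 1 4 s (E 2 3 t f) = E 2 3 t (E 1 4 s f)" for s t f
    unfolding E_def by (rule emb_commute; simp)+
  have other:
    "fac p1 1 = fac p 1" "fac p1 2 = fac p 2" "fac p1 4 = fac p 4"
    "fac p2 1 = fac p1 1" "fac p2 3 = fac p1 3" "fac p2 5 = fac p1 5"
    "fac p3 2 = fac p2 2" "fac p3 3 = fac p2 3" "fac p3 6 = fac p2 6"
    "fac p4 4 = fac p3 4" "fac p4 5 = fac p3 5" "fac p4 6 = fac p3 6"
    "fac q1 4 = fac p 4" "fac q1 5 = fac p 5" "fac q1 6 = fac p 6"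
    "fac q2 2 = fac q1 2" "fac q2 3 = fac q1 3" "fac q2 6 = fac q1 6"
    "fac q3 1 = fac q2 1" "fac q3 3 = fac q2 3" "fac q3 5 = fac q2 5"
    "fac q4 1 = fac q3 1" "fac q4 2 = fac q3 2" "fac q4 4 = fac q3 4"
    unfolding p1_def p2_def p3_def p4_def q1_def q2_def q3_def q4_def
    by (rule fac_act(4); use distinct_6 in simp)+
  have step: "E b c (fac p k) (E a c (fac p j) (E a b (fac p i) f)) =
      E a b (fac (act i j k p) i) (E a c (fac (act i j k p) j) (E b c (fac (act i j k p) k) f))"
    if "distinct [i, j, k]" "regular (fac p i) (fac p j) (fac p k)" "distinct [a, b, c]"
    for p :: "6 \<times> 3 \<Rightarrow> 'a" and i j k a b c f
    unfolding E_def by (rule emb_act[OF that])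
  have p1: "E 3 4 (fac p 6) (E 2 4 (fac p 5) (E 2 3 (fac p 3) f)) =
      E 2 3 (fac p1 3) (E 2 4 (fac p1 5) (E 3 4 (fac p1 6) f))" for f
    unfolding p1_def by (rule step[OF dist(1) regular(1)]) simp
  have p2: "E 3 4 (fac p1 6) (E 1 4 (fac p1 4) (E 1 3 (fac p1 2) f)) =
      E 1 3 (fac p2 2) (E 1 4 (fac p2 4) (E 3 4 (fac p2 6) f))" for f
    unfolding p2_def by (rule step[OF dist(2) regular(2)]) simp
  have p3: "E 2 4 (fac p2 5) (E 1 4 (fac p2 4) (E 1 2 (fac p2 1) f)) =
      E 1 2 (fac p3 1) (E 1 4 (fac p3 4) (E 2 4 (fac p3 5) f))" for f
    unfolding p3_def by (rule step[OF dist(3) regular(3)]) simp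
  have p4: "E 2 3 (fac p3 3) (E 1 3 (fac p3 2) (E 1 2 (fac p3 1) f)) =
      E 1 2 (fac p4 1) (E 1 3 (fac p4 2) (E 2 3 (fac p4 3) f))" for f
    unfolding p4_def by (rule step[OF dist(4) regular(4)]) simp
  have q1: "E 2 3 (fac p 3) (E 1 3 (fac p 2) (E 1 2 (fac p 1) f)) =
      E 1 2 (fac q1 1) (E 1 3 (fac q1 2) (E 2 3 (fac q1 3) f))" for f
    unfolding q1_def by (rule step[OF dist(4) regular(5)]) simp
  have q2: "E 2 4 (fac q1 5) (E 1 4 (fac q1 4) (E 1 2 (fac q1 1) f)) =
      E 1 2 (fac q2 1) (E 1 4 (fac q2 4) (E 2 4 (fac q2 5) f))" for f
    unfolding q2_def by (rule step[OF dist(3) regular(6)]) simp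
  have q3: "E 3 4 (fac q2 6) (E 1 4 (fac q2 4) (E 1 3 (fac q2 2) f)) =
      E 1 3 (fac q3 2) (E 1 4 (fac q3 4) (E 3 4 (fac q3 6) f))" for f
    unfolding q3_def by (rule step[OF dist(2) regular(7)]) simp
  have q4: "E 3 4 (fac q3 6) (E 2 4 (fac q3 5) (E 2 3 (fac q3 3) f)) =
      E 2 3 (fac q4 3) (E 2 4 (fac q4 5) (E 3 4 (fac q4 6) f))" for f
    unfolding q4_def by (rule step[OF dist(1) regular(8)]) simp
  let ?I = "\<lambda>f. E 3 4 (fac p 6) (E 2 4 (fac p 5) (E 2 3 (fac p 3)
      (E 1 4 (fac p 4) (E 1 3 (fac p 2) (E 1 2 (fac p 1) f)))))"
  have "?I f = E 2 3 (fac p1 3) (E 2 4 (fac p1 5) (E 3 4 (fac p1 6)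
      (E 1 4 (fac p1 4) (E 1 3 (fac p1 2) (E 1 2 (fac p1 1) f)))))" for f
    by (simp only: p1[unfolded other] other)
  also have "\<dots> f = E 2 3 (fac p2 3) (E 1 3 (fac p2 2) (E 2 4 (fac p2 5)
      (E 1 4 (fac p2 4) (E 1 2 (fac p2 1) (E 3 4 (fac p2 6) f)))))" for f
    by (simp only: p2[unfolded other] other comm)
  also have "\<dots> f = E 2 3 (fac p3 3) (E 1 3 (fac p3 2) (E 1 2 (fac p3 1)
      (E 1 4 (fac p3 4) (E 2 4 (fac p3 5) (E 3 4 (fac p3 6) f)))))" for f
    by (simp only: p3[unfolded other] other)
  also have "\<dots> f = E 1 2 (fac p4 1) (E 1 3 (fac p4 2) (E 2 3 (fac p4 3)
      (E 1 4 (fac p4 4) (E 2 4 (fac p4 5) (E 3 4 (fac p4 6) f)))))" for f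
    by (simp only: p4[unfolded other] other)
  finally have P: "?I f = E 1 2 (fac p4 1) (E 1 3 (fac p4 2) (E 2 3 (fac p4 3)
      (E 1 4 (fac p4 4) (E 2 4 (fac p4 5) (E 3 4 (fac p4 6) f)))))" for f .
  \<comment> \<open>Here the map in the plane 23 first passes the one in 14, so that 23, 13, 12
    become adjacent.\<close>
  have "?I f = E 3 4 (fac q1 6) (E 2 4 (fac q1 5) (E 1 4 (fac q1 4)
      (E 1 2 (fac q1 1) (E 1 3 (fac q1 2) (E 2 3 (fac q1 3) f)))))" for f
    by (simp only: comm(3)[symmetric] q1[unfolded other] other)
  also have "\<dots> f = E 1 2 (fac q2 1) (E 3 4 (fac q2 6) (E 1 4 (fac q2 4)
      (E 1 3 (fac q2 2) (E 2 4 (fac q2 5) (E 2 3 (fac q2 3) f)))))" for f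
    by (simp only: q2[unfolded other] other comm)
  also have "\<dots> f = E 1 2 (fac q3 1) (E 1 3 (fac q3 2) (E 1 4 (fac q3 4)
      (E 3 4 (fac q3 6) (E 2 4 (fac q3 5) (E 2 3 (fac q3 3) f)))))" for f
    by (simp only: q3[unfolded other] other)
  also have "\<dots> f = E 1 2 (fac q4 1) (E 1 3 (fac q4 2) (E 2 3 (fac q4 3)
      (E 1 4 (fac q4 4) (E 2 4 (fac q4 5) (E 3 4 (fac q4 6) f)))))" for f
    by (simp only: q4[unfolded other] other comm)
  finally have eq: "emb 1 2 (fac p4 1) (emb 1 3 (fac p4 2) (emb 2 3 (fac p4 3)
      (emb 1 4 (fac p4 4) (emb 2 4 (fac p4 5) (emb 3 4 (fac p4 6) f))))) =
    emb 1 2 (fac q4 1) (emb 1 3 (fac q4 2) (emb 2 3 (fac q4 3)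
      (emb 1 4 (fac q4 4) (emb 2 4 (fac q4 5) (emb 3 4 (fac q4 6) f)))))" for f :: "nat \<Rightarrow> 'a"
    unfolding P[symmetric] E_def[symmetric] .
  \<comment> \<open>Every step preserves all six determinants, so both ends have the prescribed
    ones.\<close>
  have detp: "qdet (fac p4 l) = qdet (fac p l)" and detq: "qdet (fac q4 l) = qdet (fac p l)" for l
    unfolding p4_def q4_def
    using dist regular
    by (simp_all add: p1_def p2_def p3_def q1_def q2_def q3_def qdet_act)
  have last: "fac p4 4 = fac q4 4" "fac p4 5 = fac q4 5" "fac p4 6 = fac q4 6"
    by (rule factorization4_last_unique[OF _ eq]; use detp detq det diag in auto)+
  have "emb 1 2 (fac p4 1) (emb 1 3 (fac p4 2) (emb 2 3 (fac p4 3) f)) =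
    emb 1 2 (fac q4 1) (emb 1 3 (fac q4 2) (emb 2 3 (fac q4 3) f))" for f :: "nat \<Rightarrow> 'a"
  proof -
    \<comment> \<open>The last three maps agree on both sides and are surjective, so they can be
      cancelled.\<close>
    have "surj (emb 1 4 (fac p4 4) \<circ> (emb 2 4 (fac p4 5) \<circ> emb (3::nat) 4 (fac p4 6)))"
      by (intro comp_surj bij_is_surj bij_emb) (simp_all add: detp det)
    then obtain g where "f = (emb 1 4 (fac p4 4) \<circ> (emb 2 4 (fac p4 5) \<circ> emb (3::nat) 4 (fac p4 6))) g"
      by (rule surjE)
    then show ?thesis using eq[of g] by (simp add: last)
  qed
  note first = factorization3_unique[OF _ this]
  have "fac p4 1 = fac q4 1" "fac p4 2 = fac q4 2" "fac p4 3 = fac q4 3"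
    by (rule first; use detp detq det diag in auto)+
  with last have "fac p4 l = fac q4 l" for l
    using exhaust_6[of l] by (elim disjE) (simp_all only:)
  then show ?thesis by (rule ext_fac)
qed

section \<open>Evaluation of rational functions\<close>

lemma rat_const_add: "rat_const (c + d) = rat_const c + rat_const d"
  by (simp add: rat_const_def single_add)

lemma rat_const_mult: "rat_const (c * d) = rat_const c * rat_const d"
  by (simp add: rat_const_def mult_single)

lemma rat_const_0 [simp]: "rat_const 0 = 0"
  by (simp add: rat_const_def Zero_fract_def)

lemma rat_const_1 [simp]: "rat_const 1 = 1"
  by (simp add: rat_const_def One_fract_def)

text \<open>Additional exponents have coefficient zero. A common index set for two polynomials makes
  additivity a termwise matter.\<close>

lemma mpoly_eval_superset:
  assumes "finite S" "Poly_Mapping.keys a \<subseteq> S"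
  shows "mpoly_eval p a =
    (\<Sum>m\<in>S. rat_const (Poly_Mapping.lookup a m) * (\<Prod>i\<in>UNIV. p i ^ Poly_Mapping.lookup m i))"
  unfolding mpoly_eval_def
  by (rule sum.mono_neutral_left) (use assms in \<open>auto simp: in_keys_iff\<close>)

lemma mpoly_eval_add: "mpoly_eval p (a + b) = mpoly_eval p a + mpoly_eval p b"
proof -
  let ?S = "Poly_Mapping.keys a \<union> Poly_Mapping.keys b"
  have "Poly_Mapping.keys (a + b) \<subseteq> ?S" by (rule keys_add)
  then show ?thesis
    by (simp add: mpoly_eval_superset[of ?S] lookup_add rat_const_add algebra_simps sum.distrib)
qed

lemma mpoly_eval_0 [simp]: "mpoly_eval p 0 = 0"
  by (simp add: mpoly_eval_def)

lemma mpoly_eval_single: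
  "mpoly_eval p (Poly_Mapping.single m c) =
     rat_const c * (\<Prod>i\<in>UNIV. p i ^ Poly_Mapping.lookup m i)"
  by (subst mpoly_eval_superset[of "{m}"]) (auto split: if_splits)

lemma mpoly_eval_1 [simp]: "mpoly_eval p 1 = 1"
  using mpoly_eval_single[of p 0 1] by simp

lemma poly_mapping_single_induct [case_names zero add]:
  fixes a :: "'b \<Rightarrow>\<^sub>0 'c::comm_monoid_add"
  assumes "P 0" and "\<And>m c a. P a \<Longrightarrow> P (Poly_Mapping.single m c + a)"
  shows "P a"
proof (induct a rule: update_induct)
  case const
  then show ?case by (fact assms(1))
next
  case (update a k c)
  have "Poly_Mapping.update k c a = Poly_Mapping.single k c + a"
    using update by (intro poly_mapping_eqI)
      (auto simp: lookup_update lookup_add lookup_single in_keys_iff)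
  then show ?case using assms(2) update by simp
qed

text \<open>By additivity in both arguments it suffices to multiply two monomials, whose exponents
  add.\<close>

lemma mpoly_eval_mult: "mpoly_eval p (a * b) = mpoly_eval p a * mpoly_eval p b"
proof (induct a rule: poly_mapping_single_induct)
  case (add m c a)
  have "mpoly_eval p (Poly_Mapping.single m c * b) =
      mpoly_eval p (Poly_Mapping.single m c) * mpoly_eval p b"
  proof (induct b rule: poly_mapping_single_induct)
    case (add n d b)
    then show ?case
      by (simp add: distrib_left mpoly_eval_add mult_single mpoly_eval_single rat_const_mult
          lookup_add power_add prod.distrib)
  qed simp
  then show ?case using add by (simp add: distrib_right mpoly_eval_add)
qed simp

lemma mpoly_eval_uminus: "mpoly_eval p (- a) = - mpoly_eval p a"
  using mpoly_eval_add[of p "- a" a] by (simp add: eq_neg_iff_add_eq_0)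

text \<open>Equal fractions have equal cross products, and evaluation respects products; so the
  description in \<open>rat_eval\<close> has exactly one solution.\<close>

lemma rat_eval_Fract:
  assumes "mpoly_eval p b \<noteq> 0"
  shows "rat_eval p (Fraction_Field.Fract a b) = Some (mpoly_eval p a / mpoly_eval p b)"
proof -
  have "mpoly_eval p a' / mpoly_eval p b' = mpoly_eval p a / mpoly_eval p b"
    if "Fraction_Field.Fract a b = Fraction_Field.Fract a' b'" "mpoly_eval p b' \<noteq> 0" for a' b'
  proof -
    have "a * b' = a' * b"
      using that assms by (subst (asm) eq_fract(1)) auto
    then have "mpoly_eval p a * mpoly_eval p b' = mpoly_eval p a' * mpoly_eval p b"
      by (metis mpoly_eval_mult)
    then show ?thesis using assms that by (simp add: field_simps)
  qed
  then have "(THE s. \<exists>a' b'. Fraction_Field.Fract a b = Fraction_Field.Fract a' b' \<and>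
      mpoly_eval p b' \<noteq> 0 \<and> s = mpoly_eval p a' / mpoly_eval p b') = mpoly_eval p a / mpoly_eval p b"
    using assms by (intro the_equality) blast+
  then show ?thesis using assms unfolding rat_eval_def by auto
qed

lemma rat_eval_SomeE:
  assumes "rat_eval p r = Some s"
  obtains a b where "r = Fraction_Field.Fract a b" "mpoly_eval p b \<noteq> 0"
    "s = mpoly_eval p a / mpoly_eval p b"
proof -
  obtain a b where ab: "r = Fraction_Field.Fract a b" "mpoly_eval p b \<noteq> 0"
    using assms by (auto simp: rat_eval_def split: if_splits)
  then show thesis using that assms rat_eval_Fract[of p b a] by simp
qed

lemma rat_eval_0 [simp]: "rat_eval p 0 = Some 0"
  using rat_eval_Fract[of p 1 0] by (simp flip: Zero_fract_def)

text \<open>The source of all genericity statements: zero has only the value zero, so one nonzero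
  value suffices.\<close>

lemma rat_eval_nonzero: "rat_eval p r = Some s \<Longrightarrow> s \<noteq> 0 \<Longrightarrow> r \<noteq> 0"
  by auto

lemma rat_eval_var [simp]: "rat_eval p (rat_var i) = Some (p i)"
proof -
  have "(\<Prod>j\<in>UNIV. p j ^ Poly_Mapping.lookup (Poly_Mapping.single i 1) j) =
      (\<Prod>j\<in>UNIV. if j = i then p j else 1)"
    by (intro prod.cong) (auto simp: lookup_single)
  then show ?thesis
    unfolding rat_var_def by (subst rat_eval_Fract) (simp_all add: mpoly_eval_single)
qed

lemma rat_eval_add:
  assumes "rat_eval p r = Some s" "rat_eval p r' = Some s'"
  shows "rat_eval p (r + r') = Some (s + s')"
proof -
  obtain a b where ab: "r = Fraction_Field.Fract a b" "mpoly_eval p b \<noteq> 0"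
    "s = mpoly_eval p a / mpoly_eval p b"
    using assms(1) by (rule rat_eval_SomeE)
  obtain a' b' where ab': "r' = Fraction_Field.Fract a' b'" "mpoly_eval p b' \<noteq> 0"
    "s' = mpoly_eval p a' / mpoly_eval p b'"
    using assms(2) by (rule rat_eval_SomeE)
  have "b \<noteq> 0" "b' \<noteq> 0" using ab ab' by auto
  then have "r + r' = Fraction_Field.Fract (a * b' + a' * b) (b * b')"
    using ab ab' by simp
  moreover have "s + s' = mpoly_eval p (a * b' + a' * b) / mpoly_eval p (b * b')"
    using ab ab' by (simp add: mpoly_eval_add mpoly_eval_mult field_simps)
  ultimately show ?thesis
    using ab ab' by (simp add: rat_eval_Fract mpoly_eval_mult)
qed

lemma rat_eval_uminus:
  assumes "rat_eval p r = Some s"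
  shows "rat_eval p (- r) = Some (- s)"
  using assms by (elim rat_eval_SomeE) (simp add: rat_eval_Fract mpoly_eval_uminus)

lemma rat_eval_diff:
  assumes "rat_eval p r = Some s" "rat_eval p r' = Some s'"
  shows "rat_eval p (r - r') = Some (s - s')"
  using rat_eval_add[OF assms(1) rat_eval_uminus[OF assms(2)]] by simp

lemma rat_eval_mult:
  assumes "rat_eval p r = Some s" "rat_eval p r' = Some s'"
  shows "rat_eval p (r * r') = Some (s * s')"
  using assms by (elim rat_eval_SomeE) (simp add: rat_eval_Fract mpoly_eval_mult)

lemma rat_eval_inverse:
  assumes "rat_eval p r = Some s" "s \<noteq> 0"
  shows "rat_eval p (inverse r) = Some (inverse s)"
  using assms by (elim rat_eval_SomeE) (simp add: rat_eval_Fract)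

lemma rat_eval_divide:
  assumes "rat_eval p r = Some s" "rat_eval p r' = Some s'" "s' \<noteq> 0"
  shows "rat_eval p (r / r') = Some (s / s')"
  using rat_eval_mult[OF assms(1) rat_eval_inverse[OF assms(2,3)]] by (simp add: divide_inverse)

section \<open>Specialization at identity matrices\<close>

lemmas rat_eval_intros = rat_eval_divide rat_eval_mult rat_eval_add rat_eval_diff

lemma rat_eval_tet_denom:
  assumes "\<And>m. rat_eval q (p m) = Some (s m)"
  shows "rat_eval q (tet_denom (fac p i) (fac p j) (fac p k)) =
    Some (tet_denom (fac s i) (fac s j) (fac s k))"
  unfolding tet_denom_def fac_def prod.case by (intro rat_eval_intros assms)

lemma rat_eval_qdet:
  assumes "\<And>m. rat_eval q (p m) = Some (s m)"
  shows "rat_eval q (qdet (fac p l)) = Some (qdet (fac s l))"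
  unfolding qdet_def fac_def prod.case by (intro rat_eval_intros assms)

lemma rat_eval_point3:
  assumes "rat_eval q a1 = Some b1" "rat_eval q a2 = Some b2" "rat_eval q a3 = Some b3"
    "rat_eval q a4 = Some b4" "rat_eval q a5 = Some b5" "rat_eval q a6 = Some b6"
    "rat_eval q a7 = Some b7" "rat_eval q a8 = Some b8" "rat_eval q a9 = Some b9"
  shows "rat_eval q (point3 (a1, a2, a3) (a4, a5, a6) (a7, a8, a9) m) =
    Some (point3 (b1, b2, b3) (b4, b5, b6) (b7, b8, b9) m)"
  using assms by (cases m) (simp add: point3_def)

text \<open>The formulas use only field operations, and \<open>regular\<close> keeps their
  denominators nonzero at \<open>s\<close>; hence evaluation commutes with
  \<open>tet\<close>.\<close>

lemma rat_eval_tet: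
  assumes p: "\<And>m. rat_eval q (p m) = Some (s m)"
    and reg: "regular (fac s i) (fac s j) (fac s k)"
  shows "rat_eval q (tet (fac p i) (fac p j) (fac p k) m) =
    Some (tet (fac s i) (fac s j) (fac s k) m)"
proof -
  note D = rat_eval_tet_denom[OF p, where i = i and j = j and k = k, unfolded fac_def]
  have nz: "s (i, 1) * s (i, 2) - s (i, 3) \<noteq> 0" "s (k, 1) * s (k, 2) - s (k, 3) \<noteq> 0"
      "tet_denom (s (i, 1), s (i, 2), s (i, 3)) (s (j, 1), s (j, 2), s (j, 3))
        (s (k, 1), s (k, 2), s (k, 3)) \<noteq> 0"
    using reg by (auto simp: regular_def qdet_def fac_def)
  show ?thesis
    unfolding tet_def fac_def Let_def prod.case
    by (intro rat_eval_point3 rat_eval_intros D p) (use nz in simp_all)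
qed

lemma rat_eval_act:
  assumes "\<And>m. rat_eval q (p m) = Some (s m)"
    and "regular (fac s i) (fac s j) (fac s k)"
  shows "rat_eval q (act i j k p m) = Some (act i j k s m)"
proof (cases m)
  case (Pair l c)
  show ?thesis
    unfolding act_def Let_def Pair prod.case
    using rat_eval_tet[OF assms, of "(1, c)"] rat_eval_tet[OF assms, of "(2, c)"]
      rat_eval_tet[OF assms, of "(3, c)"] assms(1)[of "(l, c)"]
    by simp
qed

lemma regular_of_rat_eval:
  assumes "\<And>m. rat_eval q (p m) = Some (s m)"
    and "regular (fac s i) (fac s j) (fac s k)"
  shows "regular (fac p i) (fac p j) (fac p k)"
  using assms(2) unfolding regular_def
  by (intro conjI rat_eval_nonzero[OF rat_eval_qdet[OF assms(1)]]
      rat_eval_nonzero[OF rat_eval_tet_denom[OF assms(1)]]) simp_all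

text \<open>Substituting \<open>p\<close> into the generic map is evaluation at \<open>p\<close>,
  where the variables take the coordinates of \<open>p\<close> as values.\<close>

lemma ratmap_app_tet:
  assumes "regular (fac p 1) (fac p 2) (fac p 3)"
  shows "ratmap_app (tet (fac rat_var 1) (fac rat_var 2) (fac rat_var 3)) p =
    Some (tet (fac p 1) (fac p 2) (fac p 3))"
  using rat_eval_tet[OF rat_eval_var assms] by (simp add: ratmap_app_def)

lemma factor_act_tet:
  assumes "regular (fac p i) (fac p j) (fac p k)"
  shows "factor_act (tet (fac rat_var 1) (fac rat_var 2) (fac rat_var 3)) i j k p =
    Some (act i j k p)"
proof -
  have "fac (\<lambda>(f, c). p (if f = 1 then i else if f = 2 then j else k, c)) =
      (\<lambda>f :: 3. fac p (if f = 1 then i else if f = 2 then j else k))"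
    by (simp add: fac_def fun_eq_iff)
  then show ?thesis
    using assms by (simp add: factor_act_def ratmap_app_tet act_def fun_eq_iff)
qed

text \<open>Every factor is the identity matrix \<open>M 0 0 1\<close>. Both determinants in
  \<open>regular\<close> and \<Delta> equal 1 there.\<close>

definition unit_point :: "'n \<times> 3 \<Rightarrow> 'a::field" where
  "unit_point = (\<lambda>(l, c). if c = 3 then 1 else 0)"

lemma fac_unit_point [simp]: "fac unit_point l = (0, 0, 1)"
  by (simp add: fac_def unit_point_def)

lemma regular_unit_point: "regular (fac unit_point i) (fac unit_point j) (fac unit_point k)"
  by (simp add: regular_def qdet_def tet_denom_def)

lemma act_unit_point [simp]:
  assumes "distinct [i, j, k]"
  shows "act i j k unit_point = unit_point"
proof (rule ext_fac)
  fix l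
  show "fac (act i j k unit_point) l = fac unit_point l"
    using fac_act[OF assms, where p = unit_point]
    by (cases "l \<in> {i, j, k}") (auto simp: tet_def tet_denom_def)
qed

text \<open>The invariant carried along composites: the map is defined at the unit point and fixes
  it. It survives each \<open>act\<close> and forces regularity of any three factors.\<close>

definition through_unit :: "('n::{finite,linorder} \<times> 3, 'n \<times> 3) ratmap \<Rightarrow> bool" where
  "through_unit p \<longleftrightarrow>
     (\<forall>i. rat_eval (unit_point :: 'n \<times> 3 \<Rightarrow> ('n \<times> 3) ratfun) (p i) = Some (unit_point i))"

lemma through_unitD:
  fixes p :: "('n::{finite,linorder} \<times> 3, 'n \<times> 3) ratmap"
  shows "through_unit p \<Longrightarrow>
    rat_eval (unit_point :: 'n \<times> 3 \<Rightarrow> ('n \<times> 3) ratfun) (p i) = Some (unit_point i)"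
  unfolding through_unit_def by (rule spec)

lemma through_unit_var: "through_unit rat_var"
  by (simp add: through_unit_def)

lemma through_unit_act:
  assumes "through_unit p" "distinct [i, j, k]"
  shows "through_unit (act i j k p)"
  unfolding through_unit_def
  using rat_eval_act[OF through_unitD[OF assms(1)] regular_unit_point, of i j k]
  by (simp only: act_unit_point[OF assms(2)] simp_thms)

lemma through_unit_regular:
  "through_unit p \<Longrightarrow> regular (fac p i) (fac p j) (fac p k)"
  by (rule regular_of_rat_eval[OF through_unitD regular_unit_point])

lemma through_unit_diag:
  assumes "through_unit p"
  shows "snd (snd (fac p l)) \<noteq> 0"
proof -
  have "p (l, 3) \<noteq> 0"
    by (rule rat_eval_nonzero[OF through_unitD[OF assms]]) (simp add: unit_point_def)
  then show ?thesis by (simp add: fac_def)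
qed

section \<open>The tetrahedron equation and noninvolutivity for the generic map\<close>

lemma tetrahedron_map_tet:
  "tetrahedron_map (tet (fac rat_var 1) (fac rat_var 2) (fac rat_var 3))"
proof -
  have dist: "distinct [3, 5, 6 :: 6]" "distinct [2, 4, 6 :: 6]" "distinct [1, 4, 5 :: 6]"
      "distinct [1, 2, 3 :: 6]"
    using distinct_6 by simp_all
  \<comment> \<open>All intermediate maps pass through the unit point, so every
    \<open>factor_act\<close> is defined and equals \<open>act\<close>, and all regularity
    hypotheses hold.\<close>
  note unit = through_unit_var through_unit_act dist through_unit_regular
  have "act 1 2 3 (act 1 4 5 (act 2 4 6 (act 3 5 6 rat_var))) =
      act 3 5 6 (act 2 4 6 (act 1 4 5 (act 1 2 3 (rat_var :: 6 \<times> 3 \<Rightarrow> (6 \<times> 3) ratfun))))"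
  proof (rule tetrahedron_act)
    show "qdet (fac (rat_var :: 6 \<times> 3 \<Rightarrow> (6 \<times> 3) ratfun) l) \<noteq> 0" for l
      using through_unit_regular[OF through_unit_var] by (auto simp: regular_def)
  qed (intro through_unit_diag unit)+
  then show ?thesis
    unfolding tetrahedron_map_def map_comp_def
    by (simp add: factor_act_tet unit)
qed

text \<open>
  If the map were an involution, its coordinate \<open>w2\<close> would give $u_1v_2+x_1y_2=0$.
\<close>

lemma noninvolutive_tet:
  "noninvolutive (tet (fac rat_var 1) (fac rat_var 2) (fac rat_var 3))"
proof -
  let ?v = "rat_var :: 3 \<times> 3 \<Rightarrow> (3 \<times> 3) ratfun"
  define T where "T = act 1 2 3 ?v"
  have T: "T = tet (fac ?v 1) (fac ?v 2) (fac ?v 3)"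
    by (simp add: T_def act_3)
  have "regular (fac T 1) (fac T 2) (fac T 3)"
    unfolding T_def by (intro through_unit_regular through_unit_act through_unit_var distinct_3)
  then have app: "ratmap_app T T = Some (tet (fac T 1) (fac T 2) (fac T 3))"
    by (subst (1) T) (rule ratmap_app_tet)
  have w2: "tet (fac p 1) (fac p 2) (fac p 3) (3, 2) = p (1, 1) * p (2, 2) + p (3, 2)"
    for p :: "3 \<times> 3 \<Rightarrow> (3 \<times> 3) ratfun"
    by (simp add: tet_def fac_def point3_def Let_def)
  have u1: "T (1, 1) = (?v (1, 1) * (?v (2, 1) * ?v (2, 2) - ?v (2, 3)) + ?v (2, 1) * ?v (3, 2)) /
      (?v (3, 1) * ?v (3, 2) - ?v (3, 3))"
    and v2: "T (2, 2) = ?v (1, 2) * ?v (3, 2) + ?v (2, 2) * ?v (1, 3)"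
    by (simp_all add: T tet_def fac_def point3_def Let_def)
  have nz: "?v (3, 1) * ?v (3, 2) - ?v (3, 3) \<noteq> 0"
    using through_unit_regular[OF through_unit_var, of "3 :: 3" 3 3]
    by (auto simp: regular_def qdet_def fac_def)
  \<comment> \<open>The numerator of \<open>u1 * v2 + x1 * y2\<close> over the denominator
    \<open>z1 * z2 - Z\<close>.\<close>
  define h where "h = (?v (1, 1) * (?v (2, 1) * ?v (2, 2) - ?v (2, 3)) + ?v (2, 1) * ?v (3, 2)) *
       (?v (1, 2) * ?v (3, 2) + ?v (2, 2) * ?v (1, 3)) +
       ?v (1, 1) * ?v (2, 2) * (?v (3, 1) * ?v (3, 2) - ?v (3, 3))"
  \<comment> \<open>With \<open>x1 = x2 = 0\<close> and all other coordinates 1, only the term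
    \<open>y1 * z2 * y2 * X\<close> of \<open>h\<close> survives. The denominator
    \<open>z1 * z2 - Z\<close> vanishes at this point, which is why the polynomial \<open>h\<close>
    is evaluated instead of the fraction.\<close>
  define e :: "3 \<times> 3 \<Rightarrow> (3 \<times> 3) ratfun"
    where "e = (\<lambda>i. if i = (1, 1) \<or> i = (1, 2) then 0 else 1)"
  have "rat_eval e h = Some ((e (1, 1) * (e (2, 1) * e (2, 2) - e (2, 3)) + e (2, 1) * e (3, 2)) *
       (e (1, 2) * e (3, 2) + e (2, 2) * e (1, 3)) +
       e (1, 1) * e (2, 2) * (e (3, 1) * e (3, 2) - e (3, 3)))"
    unfolding h_def by (intro rat_eval_intros rat_eval_var)
  also have "\<dots> = Some 1" by (simp add: e_def)
  finally have "h \<noteq> 0" by (rule rat_eval_nonzero) simp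
  have "tet (fac T 1) (fac T 2) (fac T 3) \<noteq> ?v"
  proof
    assume "tet (fac T 1) (fac T 2) (fac T 3) = ?v"
    then have "T (1, 1) * T (2, 2) + T (3, 2) = ?v (3, 2)" by (simp flip: w2)
    moreover have "T (3, 2) = ?v (1, 1) * ?v (2, 2) + ?v (3, 2)" by (simp only: T w2)
    ultimately have "T (1, 1) * T (2, 2) + ?v (1, 1) * ?v (2, 2) = 0" by simp
    then have "h = 0" using nz unfolding h_def u1 v2 by (simp add: field_simps)
    with \<open>h \<noteq> 0\<close> show False ..
  qed
  with app show ?thesis unfolding noninvolutive_def T[symmetric] by blast
qed

theorem proposition4p1:
  fixes x1 x2 X y1 y2 Y z1 z2 Z \<Delta> :: "(3 \<times> 3) ratfun"
    and T :: "(3 \<times> 3, 3 \<times> 3) ratmap"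
  assumes variables: "point3 (x1, x2, X) (y1, y2, Y) (z1, z2, Z) = rat_var"
    and Delta: "\<Delta> = y1 * y2 * z1 * (x1 * y2 + z2) * X - (x1 * y2 * z1 + z1 * z2 - Z) * X * Y
                  + x2 * (y1 * z2 + x1 * (y1 * y2 - Y)) * Z"
    and T: "T = point3
      ((x1 * (y1 * y2 - Y) + y1 * z2) / (z1 * z2 - Z),
       ((x1 * x2 - X) * (y2 * z1 * X + x2 * Z) * (z1 * z2 - Z)) / \<Delta>,
       ((x1 * x2 - X) * (z1 * z2 - Z) * X * Y) / \<Delta>)
      ((x1 * z1 * (y1 * y2 - Y) + y1 * Z) / ((x1 * x2 - X) * (z1 * z2 - Z)),
       x2 * z2 + y2 * X,
       \<Delta> / ((x1 * x2 - X) * (z1 * z2 - Z)))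
      (((x2 * y1 * Z + z1 * (y1 * y2 - Y) * X) * (z1 * z2 - Z)) / \<Delta>,
       x1 * y2 + z2,
       ((x1 * x2 - X) * (z1 * z2 - Z) * Y * Z) / \<Delta>)"
  shows "(\<forall>u1 u2 U v1 v2 V w1 w2 W :: (3 \<times> 3) ratfun.
            (ext12 (M u1 u2 U) ** ext13 (M v1 v2 V) ** ext23 (M w1 w2 W) =
               ext23 (M z1 z2 Z) ** ext13 (M y1 y2 Y) ** ext12 (M x1 x2 X) \<and>
             U - u1 * u2 = X - x1 * x2)
            \<longleftrightarrow> point3 (u1, u2, U) (v1, v2, V) (w1, w2, W) = T) \<and>
         tetrahedron_map T \<and> noninvolutive T"
proof -
  have vars: "fac rat_var 1 = (x1, x2, X)" "fac rat_var 2 = (y1, y2, Y)" "fac rat_var 3 = (z1, z2, Z)"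
    by (simp_all flip: variables)
  have D: "\<Delta> = tet_denom (x1, x2, X) (y1, y2, Y) (z1, z2, Z)"
    by (simp add: Delta tet_denom_def)
  have T: "T = tet (fac rat_var 1) (fac rat_var 2) (fac rat_var 3)"
    unfolding T vars tet_def Let_def prod.case D by (rule refl)
  have "regular (x1, x2, X) (y1, y2, Y) (z1, z2, Z)"
    unfolding vars[symmetric] by (rule through_unit_regular[OF through_unit_var])
  then show ?thesis
    using tetrahedron_map_tet noninvolutive_tet
    \<comment> \<open>The matrix equation becomes \<open>lyb\<close>, and the scalar equation is
      equality of \<open>qdet\<close> for the first factors.\<close>
    unfolding T regular_def vars matrix_equation_iff_lyb
    by (simp flip: tet_iff add: qdet_def)
qed

end
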